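(* For every integer $k\ge 2$, there exists a graph $G$ with acyclic chromatic number $k$ such that $\operatorname{diam}(I(G))=2k-2$.
   Context: All graphs are finite, simple and undirected. For a positive integer $k$, $[k]=\{1,\dots,k\}$. An orientation of $G$ assigns a direction to each edge of $G$. Given an orientation $\vec G$ of $G$ and a set $X\subseteq V(G)$, the inversion of $X$ is the operation that reverses the orientation of every arc with both endpoints in $X$. The inversion graph $I(G)$ has as its vertices the labeled orientations of $G$, two orientations being adjacent when one is obtained from the other by a single inversion. The inversion diameter $\operatorname{diam}(I(G))$ is the diameter of $I(G)$, i.e. the largest, over all pairs of orientations of $G$, of the minimum number of inversions transforming one into the other. A proper coloring $c:V(G)\to[k]$ is acyclic if, for every pair of distinct colors $i,j\in[k]$, the subgraph induced by the vertices of colors $i$ and $j$ is a forest. The acyclic chromatic number $\chi_a(G)$ is the minimum number $k$ (a positive integer) of colors in an acyclic coloring of $G$. *)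

theory Defs
  imports "Graph_Theory.Graph_Theory" "HOL-Library.FuncSet"
begin

text \<open>
  A finite simple undirected graph is a \<open>pair_graph\<close>: a finite loopless symmetric digraph
  whose arcs are pairs of vertices; the edge \<open>uv\<close> is the pair of arcs \<open>(u, v)\<close>, \<open>(v, u)\<close>.
\<close>

definition orientations :: "'a pair_pre_digraph \<Rightarrow> 'a rel set" where
  "orientations G = {D. D \<subseteq> parcs G \<and> (\<forall>(u, v) \<in> parcs G. (u, v) \<in> D \<longleftrightarrow> (v, u) \<notin> D)}"

definition invert :: "'a set \<Rightarrow> 'a rel \<Rightarrow> 'a rel" where
  "invert X D = {(u, v). if u \<in> X \<and> v \<in> X then (v, u) \<in> D else (u, v) \<in> D}"

text \<open>
  Inverting a set that spans no edge changes nothing; the condition \<open>D \<noteq> D'\<close> excludes the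
  loops this would produce.
\<close>

definition inversion_graph :: "'a pair_pre_digraph \<Rightarrow> 'a rel pair_pre_digraph" where
  "inversion_graph G =
    \<lparr> pverts = orientations G,
      parcs = {(D, D'). D \<in> orientations G \<and> D' \<in> orientations G \<and> D \<noteq> D' \<and>
                 (\<exists>X \<subseteq> pverts G. D' = invert X D)} \<rparr>"

lemma invert_invert: "invert X (invert X D) = D"
  by (auto simp: invert_def)

lemma pair_graph_inversion_graph:
  assumes "pair_graph G"
  shows "pair_graph (inversion_graph G)"
proof -
  interpret pair_graph G by fact
  have "orientations G \<subseteq> Pow (parcs G)"
    by (auto simp: orientations_def)
  then have fin: "finite (orientations G)"
    using pair_finite_arcs by (meson finite_Pow_iff finite_subset)
  have "parcs (inversion_graph G) \<subseteq> orientations G \<times> orientations G"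
    by (auto simp: inversion_graph_def)
  then have "finite (parcs (inversion_graph G))"
    using fin by (meson finite_SigmaI finite_subset)
  moreover have "symmetric (inversion_graph G)"
    unfolding symmetric_def sym_def by (simp add: inversion_graph_def) (metis invert_invert)
  ultimately show ?thesis
    using fin by unfold_locales (auto simp: inversion_graph_def)
qed

text \<open>
  The distance is the library's shortest-path distance \<open>wf_digraph.\<mu>\<close> with unit arc weights,
  which is \<open>\<infinity>\<close> between vertices not joined by a walk.
\<close>

definition graph_diameter :: "'a pair_pre_digraph \<Rightarrow> ereal" where
  "graph_diameter G = (SUP u \<in> pverts G. SUP v \<in> pverts G. wf_digraph.\<mu> G (\<lambda>_. 1) u v)"

text \<open>
  The library predicate \<open>forest\<close> forbids all directed cycles, hence every edge of a symmetric
  digraph (as the 2-cycle \<open>u, v, u\<close>). The cycles of an undirected graph are the directed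
  cycles of length at least 3.
\<close>

definition undirected_forest :: "('a, 'b) pre_digraph \<Rightarrow> bool" where
  "undirected_forest G \<longleftrightarrow> \<not> (\<exists>p. pre_digraph.cycle G p \<and> length p \<ge> 3)"

definition acyclic_coloring :: "'a pair_pre_digraph \<Rightarrow> nat \<Rightarrow> ('a \<Rightarrow> nat) \<Rightarrow> bool" where
  "acyclic_coloring G k c \<longleftrightarrow>
     c \<in> pverts G \<rightarrow> {1..k} \<and>
     (\<forall>(u, v) \<in> parcs G. c u \<noteq> c v) \<and>
     (\<forall>i \<in> {1..k}. \<forall>j \<in> {1..k}. i \<noteq> j \<longrightarrow>
        undirected_forest (with_proj G \<restriction> {v \<in> pverts G. c v = i \<or> c v = j}))"

definition acyclic_chromatic_number :: "'a pair_pre_digraph \<Rightarrow> nat" where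
  "acyclic_chromatic_number G = (LEAST k. k \<ge> 1 \<and> (\<exists>c. acyclic_coloring G k c))"

end

theory Submission
  imports Defs "HOL-Library.Z2" "HOL-Library.Nat_Bijection"
begin

text \<open>
  A sequence of \<open>t\<close> inversions gives every vertex \<open>v\<close> a vector \<open>x\<^sub>v\<close> over the field with two
  elements, whose \<open>i\<close>-th entry records whether \<open>v\<close> lies in the \<open>i\<close>-th inverted set. The edge \<open>uv\<close>
  is reversed in total iff the dot product of \<open>x\<^sub>u\<close> and \<open>x\<^sub>v\<close> is 1 (\<open>fold_invert_eq_iff\<close>). So the
  inversion diameter is the least \<open>t\<close> such that every 0-1 labelling of the edges is realized by
  the dot products of some assignment of vectors of length \<open>t\<close>.

  The graph is built in layers. Each new vertex is joined to a set of old vertices with pairwise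
  distinct colours, all different from its own colour, and all such sets occur, with all 0-1
  labellings of the new edges. The most recent vertex of a cycle has two neighbours on it, which
  are older and hence of different colours; so no cycle uses only two colours and the colouring
  is acyclic. Cliques of size \<open>k\<close> arise, so fewer than \<open>k\<close> colours do not suffice.

  Upper bound (\<open>exists_vectors_of_rainbow_back_neighbours\<close>): give a vertex of colour \<open>j\<close> the
  vector \<open>(a\<^sub>j + w, w)\<close> with both halves of length \<open>k - 1\<close>, where \<open>a\<^sub>1, \<dots>, a\<^sub>k\<close> are the unit vectors
  and their sum. The summand \<open>w \<cdot> w'\<close> occurs twice in a dot product and cancels, which leaves
  a condition that is affine in \<open>w\<close> with linear part \<open>a\<^sub>i \<cdot> w\<close> for each older neighbour of
  colour \<open>i\<close>. There is at most one such neighbour for each \<open>i \<noteq> j\<close>, and any \<open>k - 1\<close> of the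
  vectors \<open>a\<^sub>i\<close> are linearly independent, so the vectors can be chosen one after the other.

  Lower bound (\<open>dimension_ge_of_rainbow_extensions\<close>): a totally isotropic subspace has at most
  half the dimension of the space (\<open>two_card_isotropic_le\<close>), so it suffices to find \<open>k - 1\<close>
  independent, pairwise orthogonal isotropic vectors. The labels force orthogonality between
  vertices, and independence comes for free because every pattern on a rainbow set of size at
  most \<open>k - 1\<close> is realized by a later vertex. What no label controls is the product of a vector
  with itself. If an isotropic vertex is found it is collected. If all candidates have
  self-product 1, label them so that their mutual products are 1 as well; then the sums of two
  of them are isotropic and pairwise orthogonal (\<open>isotropic_clique_extension\<close>).
\<close>

section \<open>Inversion sequences as vectors over the field with two elements\<close>

definition bit_dot :: "nat \<Rightarrow> (nat \<Rightarrow> bit) \<Rightarrow> (nat \<Rightarrow> bit) \<Rightarrow> bit" where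
  "bit_dot d x y = (\<Sum>i<d. x i * y i)"

lemma bit_dot_commute: "bit_dot d x y = bit_dot d y x"
  unfolding bit_dot_def by (rule sum.cong[OF refl mult.commute])

lemma bit_dot_add_left: "bit_dot d (\<lambda>i. x i + y i) z = bit_dot d x z + bit_dot d y z"
  unfolding bit_dot_def distrib_right sum.distrib ..

lemma bit_dot_add_right: "bit_dot d z (\<lambda>i. x i + y i) = bit_dot d z x + bit_dot d z y"
  unfolding bit_dot_def distrib_left sum.distrib ..

lemma bit_dot_sum_right: "bit_dot d z (\<lambda>i. \<Sum>a\<in>I. f a * t a i) = (\<Sum>a\<in>I. f a * bit_dot d z (t a))"
  unfolding bit_dot_def sum_distrib_left mult.left_commute[of "z _"] by (rule sum.swap)

definition membership_vector :: "'a set list \<Rightarrow> 'a \<Rightarrow> nat \<Rightarrow> bit" where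
  "membership_vector Xs v i = of_bool (v \<in> Xs ! i)"

lemma invert_iff:
  "(u, v) \<in> invert X D \<longleftrightarrow> (if u \<in> X \<and> v \<in> X then (v, u) \<in> D else (u, v) \<in> D)"
  by (simp add: invert_def)

lemma bit_dot_membership_vector_snoc:
  "bit_dot (length (Xs @ [X])) (membership_vector (Xs @ [X]) u) (membership_vector (Xs @ [X]) v) =
   bit_dot (length Xs) (membership_vector Xs u) (membership_vector Xs v) + of_bool (u \<in> X \<and> v \<in> X)"
  by (auto simp: bit_dot_def membership_vector_def nth_append)

text \<open>
  Each inverted set containing both ends of an edge reverses it once, so only the parity of the
  number of such sets matters.
\<close>

lemma fold_invert_iff:
  "(u, v) \<in> fold invert Xs D \<longleftrightarrow>
     (if bit_dot (length Xs) (membership_vector Xs u) (membership_vector Xs v) = 0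
      then (u, v) \<in> D else (v, u) \<in> D)"
proof (induction Xs arbitrary: u v rule: rev_induct)
  case Nil
  then show ?case by (simp add: bit_dot_def)
next
  case (snoc X Xs)
  show ?case
    unfolding bit_dot_membership_vector_snoc
    using snoc[of u v] snoc[of v u] bit_dot_commute[of "length Xs" "membership_vector Xs u"]
    by (auto simp: invert_iff)
qed

lemma invert_orientation:
  assumes "pair_graph G" "D \<in> orientations G"
  shows "invert X D \<in> orientations G"
proof -
  interpret pair_graph G by fact
  have "(v, u) \<in> parcs G" if "(u, v) \<in> parcs G" for u v
    using that sym_arcs by (auto simp: symmetric_def dest: symD)
  then show ?thesis
    using assms(2) by (fastforce simp: orientations_def invert_iff split: if_splits)
qed

lemma fold_invert_eq_iff:
  assumes "pair_graph G" "D \<in> orientations G" "D' \<in> orientations G"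
  shows "fold invert Xs D = D' \<longleftrightarrow> (\<forall>(u, v) \<in> parcs G.
    bit_dot (length Xs) (membership_vector Xs u) (membership_vector Xs v) =
      of_bool ((u, v) \<in> D \<longleftrightarrow> (u, v) \<notin> D'))"
proof -
  have "fold invert Xs D \<in> orientations G"
    using assms(2) by (induction Xs arbitrary: D) (auto intro: invert_orientation[OF assms(1)])
  then have "fold invert Xs D = D' \<longleftrightarrow>
      (\<forall>(u, v) \<in> parcs G. (u, v) \<in> fold invert Xs D \<longleftrightarrow> (u, v) \<in> D')"
    using assms(3) by (auto simp: orientations_def)
  also have "\<dots> \<longleftrightarrow> (\<forall>(u, v) \<in> parcs G.
    bit_dot (length Xs) (membership_vector Xs u) (membership_vector Xs v) =
      of_bool ((u, v) \<in> D \<longleftrightarrow> (u, v) \<notin> D'))"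
    using assms(2) by (intro ball_cong refl) (auto simp: fold_invert_iff orientations_def)
  finally show ?thesis .
qed

lemma inversions_of_awalk:
  assumes "pre_digraph.awalk (with_proj (inversion_graph G)) D p D'"
  shows "\<exists>Xs. length Xs = length p \<and> D' = fold invert Xs D"
  using assms
proof (induction p arbitrary: D)
  case Nil
  then show ?case by (auto simp: pre_digraph.awalk_def pre_digraph.cas.simps)
next
  case (Cons e p)
  interpret pre_digraph "with_proj (inversion_graph G)" .
  obtain D1 where "e = (D, D1)"
    using Cons.prems by (cases e) (auto simp: awalk_def)
  then have "(D, D1) \<in> parcs (inversion_graph G)" "set p \<subseteq> parcs (inversion_graph G)" "cas D1 p D'"
    using Cons.prems by (auto simp: awalk_def)
  moreover from this(1) have "D1 \<in> pverts (inversion_graph G)"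
    by (simp add: inversion_graph_def)
  ultimately have "awalk D1 p D'"
    by (simp add: awalk_def)
  then obtain X where "D1 = invert X D"
    using \<open>(D, D1) \<in> parcs (inversion_graph G)\<close> by (auto simp: inversion_graph_def)
  moreover obtain Xs where "length Xs = length p" "D' = fold invert Xs D1"
    using Cons.IH \<open>awalk D1 p D'\<close> by blast
  ultimately show ?case
    by (intro exI[of _ "X # Xs"]) simp
qed

text \<open>
  Inversions that leave the orientation unchanged are no arcs of the inversion graph and are
  skipped by the walk; this is why its length is only bounded by the number of inversions.
\<close>

lemma awalk_of_inversions:
  assumes "pair_graph G" "D \<in> orientations G" "\<forall>X \<in> set Xs. X \<subseteq> pverts G"
  shows "\<exists>p. pre_digraph.awalk (with_proj (inversion_graph G)) D p (fold invert Xs D) \<and>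
             length p \<le> length Xs"
  using assms(2,3)
proof (induction Xs arbitrary: D)
  case Nil
  then show ?case
    by (intro exI[of _ "[]"]) (simp add: pre_digraph.awalk_def pre_digraph.cas.simps inversion_graph_def)
next
  case (Cons X Xs)
  interpret pre_digraph "with_proj (inversion_graph G)" .
  let ?D1 = "invert X D"
  have D1: "?D1 \<in> orientations G"
    using invert_orientation assms(1) Cons.prems(1) by blast
  then obtain p where p: "awalk ?D1 p (fold invert Xs ?D1)" "length p \<le> length Xs"
    using Cons.IH[OF D1] Cons.prems(2) by auto
  show ?case
  proof (cases "?D1 = D")
    case True
    then show ?thesis using p by (intro exI[of _ p]) auto
  next
    case False
    then have "(D, ?D1) \<in> parcs (inversion_graph G)"
      using D1 Cons.prems by (auto simp: inversion_graph_def)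
    moreover have "D \<in> pverts (inversion_graph G)"
      using Cons.prems(1) by (simp add: inversion_graph_def)
    ultimately have "awalk D ((D, ?D1) # p) (fold invert Xs ?D1)"
      using p(1) by (simp add: awalk_def)
    then show ?thesis using p by (intro exI[of _ "(D, ?D1) # p"]) auto
  qed
qed

lemma graph_diameter_inversion_graph_eqI:
  assumes G: "pair_graph G"
    and upper: "\<And>D D'. D \<in> orientations G \<Longrightarrow> D' \<in> orientations G \<Longrightarrow>
      \<exists>Xs. (\<forall>X \<in> set Xs. X \<subseteq> pverts G) \<and> length Xs = t \<and> D' = fold invert Xs D"
    and lower: "D0 \<in> orientations G" "D1 \<in> orientations G"
      "\<And>Xs. D1 = fold invert Xs D0 \<Longrightarrow> t \<le> length Xs"
  shows "graph_diameter (inversion_graph G) = ereal (real t)"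
proof -
  interpret I: pair_graph "inversion_graph G"
    using G by (rule pair_graph_inversion_graph)
  have cost: "I.awalk_cost (\<lambda>_. 1) p = real (length p)" for p
    by (induction p) (simp_all)
  have verts: "pverts (inversion_graph G) = orientations G"
    by (simp add: inversion_graph_def)
  have le: "I.\<mu> (\<lambda>_. 1) D D' \<le> ereal (real t)" if D: "D \<in> orientations G" and D': "D' \<in> orientations G" for D D'
  proof -
    obtain Xs where "\<forall>X \<in> set Xs. X \<subseteq> pverts G" "length Xs = t" "D' = fold invert Xs D"
      using upper[OF D D'] by blast
    then obtain p where "I.awalk D p D'" "length p \<le> t"
      using awalk_of_inversions[OF G D] by blast
    then have "I.\<mu> (\<lambda>_. 1) D D' \<le> ereal (real (length p))"
      using I.min_cost_le_walk_cost[of D p D' "\<lambda>_. 1"] by (simp add: cost)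
    also have "\<dots> \<le> ereal (real t)" using \<open>length p \<le> t\<close> by simp
    finally show ?thesis .
  qed
  have "ereal (real t) \<le> I.\<mu> (\<lambda>_. 1) D0 D1"
    unfolding I.\<mu>_def
  proof (rule INF_greatest)
    fix p assume "p \<in> {p. I.awalk D0 p D1}"
    then obtain Xs where "length Xs = length p" "D1 = fold invert Xs D0"
      using inversions_of_awalk[of G D0 p D1] by auto
    moreover from this have "t \<le> length Xs"
      using lower(3) by blast
    ultimately show "ereal (real t) \<le> ereal (I.awalk_cost (\<lambda>_. 1) p)"
      by (simp add: cost)
  qed
  then show ?thesis
    unfolding graph_diameter_def verts using le lower(1,2)
    by (intro antisym SUP_least SUP_upper2[of D0] SUP_upper2[of D1]) auto
qed

section \<open>Totally isotropic families\<close>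

lemma bit_add_self: "(a::bit) + a = 0"
  by (cases a) simp_all

lemma bit_dot_cong:
  assumes "\<And>i. i < d \<Longrightarrow> x i = x' i"
  shows "bit_dot d x y = bit_dot d x' y"
  unfolding bit_dot_def using assms by (intro sum.cong) auto

text \<open>
  The pattern condition says that the vectors \<open>t a\<close> are linearly independent, in a form that
  matches how it is obtained below. With \<open>z J\<close> realizing the pattern \<open>J\<close>, the sums
  \<open>z J + (\<Sum>a\<in>K. t a)\<close> are pairwise distinct: products with the \<open>t b\<close> recover \<open>J\<close> by isotropy, and
  products with the \<open>z {b}\<close> then recover \<open>K\<close>. This makes \<open>2 ^ (2 * card I)\<close> vectors of
  length \<open>d\<close>.
\<close>

lemma two_card_isotropic_le:
  fixes t :: "'a \<Rightarrow> nat \<Rightarrow> bit"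
  assumes "finite I"
    and isotropic: "\<And>a b. a \<in> I \<Longrightarrow> b \<in> I \<Longrightarrow> bit_dot d (t a) (t b) = 0"
    and patterns: "\<And>J. J \<subseteq> I \<Longrightarrow> \<exists>y. \<forall>a \<in> I. bit_dot d y (t a) = of_bool (a \<in> J)"
  shows "2 * card I \<le> d"
proof -
  obtain z where z: "bit_dot d (z J) (t a) = of_bool (a \<in> J)" if "J \<subseteq> I" "a \<in> I" for J a
    using patterns by metis
  define F where "F J K i = z J i + (\<Sum>a\<in>K. 1 * t a i)" for J K i
  define supp where "supp = (\<lambda>(J, K). {i. i < d \<and> F J K i = 1})"
  have dot_t: "bit_dot d (F J K) (t b) = of_bool (b \<in> J)" if "J \<subseteq> I" "K \<subseteq> I" "b \<in> I" for J K b
  proof -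
    have "bit_dot d (t b) (\<lambda>i. \<Sum>a\<in>K. 1 * t a i) = (\<Sum>a\<in>K. 1 * 0)"
      unfolding bit_dot_sum_right using isotropic that by (intro sum.cong) auto
    then have "bit_dot d (\<lambda>i. \<Sum>a\<in>K. 1 * t a i) (t b) = 0"
      unfolding bit_dot_commute[of d _ "t b"] by simp
    then show ?thesis
      unfolding F_def bit_dot_add_left using z that by simp
  qed
  have dot_z: "bit_dot d (F J K) (z {b}) = bit_dot d (z J) (z {b}) + of_bool (b \<in> K)"
    if "J \<subseteq> I" "K \<subseteq> I" "b \<in> I" for J K b
  proof -
    have "finite K" using that \<open>finite I\<close> finite_subset by blast
    have "bit_dot d (z {b}) (\<lambda>i. \<Sum>a\<in>K. 1 * t a i) = (\<Sum>a\<in>K. if a = b then 1 else 0)"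
      unfolding bit_dot_sum_right using z[of "{b}"] that by (intro sum.cong) auto
    also have "\<dots> = of_bool (b \<in> K)"
      using \<open>finite K\<close> by (subst sum.delta) auto
    finally have "bit_dot d (\<lambda>i. \<Sum>a\<in>K. 1 * t a i) (z {b}) = of_bool (b \<in> K)"
      unfolding bit_dot_commute[of d _ "z {b}"] .
    then show ?thesis
      unfolding F_def bit_dot_add_left by simp
  qed
  have "inj_on supp (Pow I \<times> Pow I)"
  proof (rule inj_onI, clarsimp)
    fix J K J' K'
    assume sub: "J \<subseteq> I" "K \<subseteq> I" "J' \<subseteq> I" "K' \<subseteq> I" and eq: "supp (J, K) = supp (J', K')"
    have "F J K i = F J' K' i" if "i < d" for i
    proof -
      have "F J K i = 1 \<longleftrightarrow> F J' K' i = 1"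
        using eq that by (auto simp: supp_def)
      then show ?thesis
        by (cases "F J K i"; cases "F J' K' i") simp_all
    qed
    then have same: "bit_dot d (F J K) y = bit_dot d (F J' K') y" for y
      by (rule bit_dot_cong)
    have "b \<in> J \<longleftrightarrow> b \<in> J'" if "b \<in> I" for b
      using dot_t[of J K b] dot_t[of J' K' b] same[of "t b"] sub that
      by (metis of_bool_eq_iff)
    then have "J = J'" using sub by blast
    have "b \<in> K \<longleftrightarrow> b \<in> K'" if "b \<in> I" for b
      using dot_z[of J K b] dot_z[of J' K' b] same[of "z {b}"] sub that \<open>J = J'\<close>
      by (metis add_left_cancel of_bool_eq_iff)
    then show "J = J' \<and> K = K'" using sub \<open>J = J'\<close> by blast
  qed
  moreover have "supp ` (Pow I \<times> Pow I) \<subseteq> Pow {..<d}"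
    by (auto simp: supp_def)
  ultimately have "card (Pow I \<times> Pow I) \<le> card (Pow {..<d})"
    by (intro card_inj_on_le[of supp]) auto
  then have "2 ^ (2 * card I) \<le> (2::nat) ^ d"
    using \<open>finite I\<close> by (simp add: card_cartesian_product card_Pow power_add[symmetric] mult_2)
  then show ?thesis
    by (simp add: power_increasing_iff)
qed

section \<open>Few inversions suffice\<close>

text \<open>
  For \<open>l < k - 1\<close> these are the entries of the \<open>j\<close>-th unit vector if \<open>j < k\<close>, and of the all-ones
  vector if \<open>j = k\<close>; any \<open>k - 1\<close> of these \<open>k\<close> vectors form a basis.
\<close>

definition colour_vector :: "nat \<Rightarrow> nat \<Rightarrow> nat \<Rightarrow> bit" where
  "colour_vector k j l = of_bool (j = Suc l \<or> j = k)"

lemma bit_dot_colour_vector: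
  assumes "j \<in> {1..k}"
  shows "bit_dot (k - 1) (colour_vector k j) w = (if j = k then (\<Sum>l<k - 1. w l) else w (j - 1))"
proof (cases "j = k")
  case True
  have "bit_dot (k - 1) (colour_vector k j) w = (\<Sum>l<k - 1. w l)"
    unfolding bit_dot_def colour_vector_def using True by (intro sum.cong) auto
  then show ?thesis using True by simp
next
  case False
  have "bit_dot (k - 1) (colour_vector k j) w = (\<Sum>l<k - 1. if l = j - 1 then w l else 0)"
    unfolding bit_dot_def colour_vector_def using assms False by (intro sum.cong) auto
  also have "\<dots> = w (j - 1)"
    using assms False by (subst sum.delta) auto
  finally show ?thesis using False by simp
qed

text \<open>
  If \<open>i = k\<close>, the unit vectors prescribe the entries. Otherwise they prescribe all entries but
  one, and the free entry is used to adjust the total sum, which is the product with the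
  all-ones vector.
\<close>

lemma colour_vectors_solvable:
  assumes "i \<in> {1..k}"
  shows "\<exists>w. \<forall>j \<in> {1..k} - {i}. bit_dot (k - 1) (colour_vector k j) w = p j"
proof (cases "i = k")
  case True
  have "bit_dot (k - 1) (colour_vector k j) (\<lambda>l. p (Suc l)) = p j" if "j \<in> {1..k} - {i}" for j
    using that True bit_dot_colour_vector[of j k] by auto
  then show ?thesis by blast
next
  case False
  define s where "s = (\<Sum>l\<in>{..<k - 1} - {i - 1}. p (Suc l))"
  define w where "w l = (if l = i - 1 then p k + s else p (Suc l))" for l
  have "(\<Sum>l<k - 1. w l) = w (i - 1) + (\<Sum>l\<in>{..<k - 1} - {i - 1}. w l)"
    using assms False by (intro sum.remove) auto
  also have "(\<Sum>l\<in>{..<k - 1} - {i - 1}. w l) = s"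
    unfolding s_def by (intro sum.cong) (auto simp: w_def)
  also have "w (i - 1) + s = p k"
    unfolding w_def by (simp only: simp_thms if_True add.assoc bit_add_self add_0_right)
  finally have "(\<Sum>l<k - 1. w l) = p k" .
  moreover have "w (j - 1) = p j" if "j \<in> {1..k} - {i}" for j
    using that assms by (auto simp: w_def)
  ultimately have "bit_dot (k - 1) (colour_vector k j) w = p j" if "j \<in> {1..k} - {i}" for j
    using that bit_dot_colour_vector[of j k w] by auto
  then show ?thesis by blast
qed

lemma bit_dot_split:
  "bit_dot (m + n) x y = bit_dot m x y + bit_dot n (\<lambda>i. x (m + i)) (\<lambda>i. y (m + i))"
  unfolding bit_dot_def by (induction n) (simp_all only: add_0_right lessThan_0 sum.empty add_Suc_right sum.lessThan_Suc add.assoc)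

text \<open>
  The form \<open>(a + w, w)\<close> of the vectors makes the product for an edge affine in the part \<open>w\<close> of
  its later end, so that the later end can meet the demands of all its earlier neighbours by
  solving one linear system.
\<close>

lemma exists_vectors_of_rainbow_back_neighbours:
  fixes V :: "'a::linorder set" and \<pi> :: "'a \<Rightarrow> 'a \<Rightarrow> bit"
  assumes "finite V" "c \<in> V \<rightarrow> {1..k}"
    and earlier: "\<And>v. v \<in> V \<Longrightarrow> nb v \<subseteq> {u \<in> V. u < v}"
    and rainbow: "\<And>v. v \<in> V \<Longrightarrow> inj_on c (nb v)" "\<And>v. v \<in> V \<Longrightarrow> c v \<notin> c ` nb v"
  shows "\<exists>x. \<forall>v \<in> V. \<forall>u \<in> nb v. bit_dot (2 * (k - 1)) (x u) (x v) = \<pi> u v"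
proof -
  let ?a = "colour_vector k" and ?dot = "bit_dot (k - 1)"
  have "\<exists>w. \<forall>v \<in> V. \<forall>u \<in> nb v.
      ?dot (?a (c u)) (?a (c v)) + ?dot (?a (c u)) (w v) + ?dot (?a (c v)) (w u) = \<pi> u v"
    using assms
  proof (induction V rule: finite_linorder_max_induct)
    case empty
    then show ?case by simp
  next
    case (insert b A)
    have nbA: "nb v \<subseteq> {u \<in> A. u < v}" if "v \<in> insert b A" for v
      using insert.prems(2)[OF that] insert.hyps(2) that by fastforce
    have "\<exists>w. \<forall>v \<in> A. \<forall>u \<in> nb v.
      ?dot (?a (c u)) (?a (c v)) + ?dot (?a (c u)) (w v) + ?dot (?a (c v)) (w u) = \<pi> u v"
      using insert.prems nbA by (intro insert.IH) auto
    then obtain w where w: "?dot (?a (c u)) (?a (c v)) + ?dot (?a (c u)) (w v) + ?dot (?a (c v)) (w u) = \<pi> u v"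
      if "v \<in> A" "u \<in> nb v" for u v by blast
    \<comment> \<open>The product with the \<open>j\<close>-th colour vector that the edge to the neighbour of colour \<open>j\<close> demands.\<close>
    define p where "p j = (let u = inv_into (nb b) c j in
       \<pi> u b + ?dot (?a (c u)) (?a (c b)) + ?dot (?a (c b)) (w u))" for j
    have cb: "c b \<in> {1..k}" using insert.prems(1) by auto
    then obtain y where y: "?dot (?a j) y = p j" if "j \<in> {1..k} - {c b}" for j
      using colour_vectors_solvable by blast
    have y_nb: "?dot (?a (c u)) (?a (c b)) + ?dot (?a (c u)) y + ?dot (?a (c b)) (w u) = \<pi> u b"
      if u: "u \<in> nb b" for u
    proof -
      have "c u \<in> {1..k} - {c b}"
        using u insert.prems(1) nbA[of b] insert.prems(4)[of b] by (force simp: image_iff)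
      moreover have "inv_into (nb b) c (c u) = u"
        using u insert.prems(3)[of b] by (simp add: inv_into_f_f)
      ultimately have "?dot (?a (c u)) y =
          \<pi> u b + ?dot (?a (c u)) (?a (c b)) + ?dot (?a (c b)) (w u)"
        using y[of "c u"] by (simp add: p_def Let_def)
      then show ?thesis
        by (cases "\<pi> u b"; cases "?dot (?a (c u)) (?a (c b))"; cases "?dot (?a (c b)) (w u)")
          simp_all
    qed
    have "b \<notin> A" using insert.hyps(2) by blast
    show ?case
    proof (intro exI[of _ "w(b := y)"] ballI)
      fix v u assume v: "v \<in> insert b A" and u: "u \<in> nb v"
      then have "u \<noteq> b" using nbA[OF v] \<open>b \<notin> A\<close> by auto
      then show "?dot (?a (c u)) (?a (c v)) + ?dot (?a (c u)) ((w(b := y)) v) +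
            ?dot (?a (c v)) ((w(b := y)) u) = \<pi> u v"
        using y_nb[of u] w[of v u] u v \<open>b \<notin> A\<close> by (cases "v = b") (simp_all del: add_bit_eq_xor)
    qed
  qed
  then obtain w where w: "?dot (?a (c u)) (?a (c v)) + ?dot (?a (c u)) (w v) + ?dot (?a (c v)) (w u) = \<pi> u v"
      if "v \<in> V" "u \<in> nb v" for u v by blast
  define x where "x v i = (if i < k - 1 then ?a (c v) i + w v i else w v (i - (k - 1)))" for v i
  have "bit_dot (2 * (k - 1)) (x u) (x v) = \<pi> u v" if "v \<in> V" "u \<in> nb v" for u v
  proof -
    have "bit_dot (2 * (k - 1)) (x u) (x v) =
        ?dot (x u) (x v) + ?dot (\<lambda>i. x u (k - 1 + i)) (\<lambda>i. x v (k - 1 + i))"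
      unfolding mult_2 by (rule bit_dot_split)
    also have "?dot (\<lambda>i. x u (k - 1 + i)) (\<lambda>i. x v (k - 1 + i)) = ?dot (w u) (w v)"
      by (simp add: x_def)
    also have "?dot (x u) (x v) = ?dot (\<lambda>i. ?a (c u) i + w u i) (\<lambda>i. ?a (c v) i + w v i)"
      unfolding bit_dot_def by (intro sum.cong) (auto simp: x_def)
    also have "\<dots> = ?dot (?a (c u)) (?a (c v)) + ?dot (?a (c v)) (w u)
        + (?dot (?a (c u)) (w v) + ?dot (w u) (w v))"
      unfolding bit_dot_add_left bit_dot_add_right bit_dot_commute[of _ "w u" "?a (c v)"]
      by (simp only: ac_simps)
    finally have "bit_dot (2 * (k - 1)) (x u) (x v) =
        ?dot (?a (c u)) (?a (c v)) + ?dot (?a (c u)) (w v) + ?dot (?a (c v)) (w u)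
        + (?dot (w u) (w v) + ?dot (w u) (w v))"
      by (simp only: ac_simps)
    then show ?thesis
      unfolding w[OF that] bit_add_self by simp
  qed
  then show ?thesis by blast
qed

section \<open>Acyclic colorings from vertex orderings\<close>

lemma (in pre_digraph) tl_awalk_verts_eq:
  assumes "cas u p v"
  shows "tl (awalk_verts u p) = map (head G) p"
proof (cases p)
  case (Cons e es)
  have "awalk_verts w es = w # map (head G) es" if "cas w es v" for w
    using that by (induction es arbitrary: w) auto
  then show ?thesis using assms Cons by simp
qed simp

lemma (in pre_digraph) cas_nth:
  assumes "cas u p v" "p \<noteq> []"
  shows "tail G (p ! 0) = u" "head G (p ! (length p - 1)) = v"
    "\<And>i. Suc i < length p \<Longrightarrow> tail G (p ! Suc i) = head G (p ! i)"
proof -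
  have "tail G (p ! 0) = u \<and> head G (p ! (length p - 1)) = v \<and>
      (\<forall>i. Suc i < length p \<longrightarrow> tail G (p ! Suc i) = head G (p ! i))"
    using assms
  proof (induction p arbitrary: u)
    case (Cons e es)
    show ?case
    proof (cases "es = []")
      case True
      then show ?thesis using Cons.prems by simp
    next
      case False
      then have IH: "tail G (es ! 0) = head G e" "head G (es ! (length es - 1)) = v"
        "\<And>i. Suc i < length es \<Longrightarrow> tail G (es ! Suc i) = head G (es ! i)"
        using Cons by auto
      have "tail G ((e # es) ! Suc i) = head G ((e # es) ! i)" if "Suc i < length (e # es)" for i
        using that IH by (cases i) auto
      then show ?thesis using Cons.prems IH(2) False by (auto simp: nth_Cons')
    qed
  qed simp
  then show "tail G (p ! 0) = u" "head G (p ! (length p - 1)) = v"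
    "\<And>i. Suc i < length p \<Longrightarrow> tail G (p ! Suc i) = head G (p ! i)" by blast+
qed

text \<open>
  The vertex of a cycle where \<open>r\<close> is largest has two distinct neighbours on the cycle once the
  cycle has at least three arcs.
\<close>

lemma (in pre_digraph) cycle_peak:
  fixes r :: "'a \<Rightarrow> 'c::linorder"
  assumes "cycle p" "length p \<ge> 3"
  obtains e f where "e \<in> arcs G" "f \<in> arcs G" "head G e = tail G f" "tail G e \<noteq> head G f"
    "r (tail G e) \<le> r (head G e)" "r (head G f) \<le> r (head G e)"
proof -
  obtain u where u: "cas u p u" "set p \<subseteq> arcs G" "distinct (tl (awalk_verts u p))"
    using assms(1) by (auto simp: cycle_def awalk_def)
  let ?n = "length p"
  have "p \<noteq> []" using assms(2) by auto
  define h where "h i = head G (p ! i)" for i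
  have dist: "h i \<noteq> h j" if "i < ?n" "j < ?n" "i \<noteq> j" for i j
    using u(3) that by (auto simp: tl_awalk_verts_eq[OF u(1)] h_def distinct_conv_nth)
  define pred where "pred i = (if i = 0 then ?n - 1 else i - 1)" for i
  define succ where "succ i = (if i = ?n - 1 then 0 else i + 1)" for i
  have tail_pred: "tail G (p ! i) = h (pred i)" if "i < ?n" for i
    using cas_nth[OF u(1) \<open>p \<noteq> []\<close>] that
    by (cases i) (auto simp: pred_def h_def)
  have pred: "pred i < ?n" "pred (succ i) = i" "pred i \<noteq> succ i" "succ i < ?n" if "i < ?n" for i
    using that assms(2) by (auto simp: pred_def succ_def)
  have "Max (r ` h ` {..<?n}) \<in> r ` h ` {..<?n}"
    using \<open>p \<noteq> []\<close> by (intro Max_in) auto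
  then obtain i where i: "i < ?n" "Max (r ` h ` {..<?n}) = r (h i)"
    by blast
  have top: "r (h j) \<le> r (h i)" if "j < ?n" for j
    using that by (auto simp flip: i(2))
  show thesis
  proof (rule that[of "p ! i" "p ! succ i"])
    show "head G (p ! i) = tail G (p ! succ i)"
      using tail_pred[of "succ i"] pred[OF i(1)] by (simp add: h_def)
    show "tail G (p ! i) \<noteq> head G (p ! succ i)"
      using tail_pred[OF i(1)] dist[of "pred i" "succ i"] pred[OF i(1)] by (simp add: h_def)
    show "r (tail G (p ! i)) \<le> r (head G (p ! i))"
      using top[of "pred i"] tail_pred[OF i(1)] pred[OF i(1)] by (simp add: h_def)
    show "r (head G (p ! succ i)) \<le> r (head G (p ! i))"
      using top[of "succ i"] pred[OF i(1)] by (simp add: h_def)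
  qed (use u(2) i(1) pred[OF i(1)] in \<open>auto intro!: nth_mem\<close>)
qed

text \<open>
  The largest vertex of a two-coloured cycle would have two smaller neighbours on the cycle.
  Both carry the colour other than its own, contrary to the rainbow condition.
\<close>

lemma acyclic_coloring_of_rainbow_back_neighbours:
  fixes G :: "'a::linorder pair_pre_digraph"
  assumes "pair_graph G" "c \<in> pverts G \<rightarrow> {1..k}"
    and proper: "\<And>u v. (u, v) \<in> parcs G \<Longrightarrow> c u \<noteq> c v"
    and rainbow: "\<And>v. v \<in> pverts G \<Longrightarrow> inj_on c {u. (u, v) \<in> parcs G \<and> u < v}"
  shows "acyclic_coloring G k c"
proof -
  interpret pair_graph G by fact
  have sym: "(v, u) \<in> parcs G" if "(u, v) \<in> parcs G" for u v
    using that sym_arcs by (auto simp: symmetric_def dest: symD)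
  have "undirected_forest (with_proj G \<restriction> {v \<in> pverts G. c v = i \<or> c v = j})" for i j
    unfolding undirected_forest_def
  proof clarify
    let ?H = "with_proj G \<restriction> {v \<in> pverts G. c v = i \<or> c v = j}"
    fix p assume p: "pre_digraph.cycle ?H p" "3 \<le> length p"
    obtain e f where ef: "e \<in> arcs ?H" "f \<in> arcs ?H" "head ?H e = tail ?H f"
      "tail ?H e \<noteq> head ?H f" "tail ?H e \<le> head ?H e" "head ?H f \<le> head ?H e"
      by (rule pre_digraph.cycle_peak[OF p, of id]) simp
    obtain a m b where "e = (a, m)" "f = (m, b)"
      using ef(3) by (cases e; cases f) (auto simp: induce_subgraph_def)
    then have arcs: "(a, m) \<in> arcs ?H" "(m, b) \<in> arcs ?H" "a \<noteq> b" "a \<le> m" "b \<le> m"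
      using ef by (auto simp: induce_subgraph_def)
    then have G: "(a, m) \<in> parcs G" "(b, m) \<in> parcs G" "m \<in> pverts G"
      and col: "{c a, c b, c m} \<subseteq> {i, j}"
      using sym by (auto simp: induce_subgraph_def)
    have "c a = c b" "a \<noteq> m" "b \<noteq> m"
      using proper[OF G(1)] proper[OF G(2)] col by auto
    then have "a = b"
      using arcs(4,5) G by (intro inj_onD[OF rainbow[OF G(3)]]) auto
    with \<open>a \<noteq> b\<close> show False ..
  qed
  then show ?thesis
    using assms(2) proper by (auto simp: acyclic_coloring_def)
qed

section \<open>The graph\<close>

text \<open>
  A vertex is the code of its own history: its colour, the older vertices it is joined to, and
  those among them to which its edge gets label 1. As codes of sets and pairs dominate the codes
  of their members, the order of the natural numbers extends the order of construction.
\<close>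

definition vertex :: "nat \<Rightarrow> nat set \<Rightarrow> nat set \<Rightarrow> nat" where
  "vertex c A B = prod_encode (c, prod_encode (set_encode A, set_encode B))"

definition colour :: "nat \<Rightarrow> nat" where
  "colour v = fst (prod_decode v)"

definition parents :: "nat \<Rightarrow> nat set" where
  "parents v = set_decode (fst (prod_decode (snd (prod_decode v))))"

definition flipped_parents :: "nat \<Rightarrow> nat set" where
  "flipped_parents v = set_decode (snd (prod_decode (snd (prod_decode v))))"

lemma vertex_simps:
  "colour (vertex c A B) = c"
  "finite A \<Longrightarrow> parents (vertex c A B) = A"
  "finite B \<Longrightarrow> flipped_parents (vertex c A B) = B"
  by (simp_all add: vertex_def colour_def parents_def flipped_parents_def)

lemma mem_parents_less:
  assumes "u \<in> parents v"
  shows "u < v"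
proof -
  define x where "x = fst (prod_decode (snd (prod_decode v)))"
  have "odd (x div 2 ^ u)" using assms by (simp add: parents_def x_def set_decode_def)
  then have "2 ^ u \<le> x" by (metis div_less even_zero not_le)
  then have "u < x" by (meson less_exp less_le_trans)
  also have "x \<le> snd (prod_decode v)"
    unfolding x_def by (metis le_prod_encode_1 prod.collapse prod_decode_inverse)
  also have "\<dots> \<le> v"
    by (metis le_prod_encode_2 prod.collapse prod_decode_inverse)
  finally show ?thesis .
qed

primrec layer :: "nat \<Rightarrow> nat \<Rightarrow> nat set" where
  "layer k 0 = {}"
| "layer k (Suc n) = {vertex c A B | c A B. c \<in> {1..k} \<and> A \<subseteq> layer k n \<and> B \<subseteq> A \<and>
     inj_on colour A \<and> c \<notin> colour ` A}"

lemma finite_layer: "finite (layer k n)"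
proof (induction n)
  case (Suc n)
  have "layer k (Suc n) \<subseteq>
      (\<lambda>(c, A, B). vertex c A B) ` ({1..k} \<times> Pow (layer k n) \<times> Pow (layer k n))"
  proof
    fix v assume "v \<in> layer k (Suc n)"
    then obtain c A B where "v = vertex c A B" "c \<in> {1..k}" "A \<subseteq> layer k n" "B \<subseteq> A"
      by auto
    then show "v \<in> (\<lambda>(c, A, B). vertex c A B) ` ({1..k} \<times> Pow (layer k n) \<times> Pow (layer k n))"
      by (intro image_eqI[of _ _ "(c, A, B)"]) auto
  qed
  then show ?case
    using Suc by (meson finite_Pow_iff finite_SigmaI finite_atLeastAtMost finite_imageI finite_subset)
qed simp

lemma layer_mono_Suc: "layer k n \<subseteq> layer k (Suc n)"
proof (induction n)
  case (Suc n)
  then show ?case by (auto 4 5)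
qed simp

lemma layer_mono: "m \<le> n \<Longrightarrow> layer k m \<subseteq> layer k n"
  using lift_Suc_mono_le[of "layer k"] layer_mono_Suc by blast

lemma layer_memD:
  assumes "v \<in> layer k n"
  shows "colour v \<in> {1..k}" "parents v \<subseteq> layer k n" "flipped_parents v \<subseteq> parents v"
    "inj_on colour (parents v)" "colour v \<notin> colour ` parents v"
proof -
  obtain m where n: "n = Suc m" using assms by (cases n) auto
  obtain c A B where v: "v = vertex c A B" "c \<in> {1..k}" "A \<subseteq> layer k m" "B \<subseteq> A"
      "inj_on colour A" "c \<notin> colour ` A"
    using assms by (auto simp: n)
  then have "finite A" "finite B" using finite_layer finite_subset by metis+
  then show "colour v \<in> {1..k}" "parents v \<subseteq> layer k n" "flipped_parents v \<subseteq> parents v"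
    "inj_on colour (parents v)" "colour v \<notin> colour ` parents v"
    using v layer_mono_Suc[of k m] by (auto simp: vertex_simps n simp del: layer.simps)
qed

lemma layer_extension:
  assumes "W \<subseteq> layer k n" "inj_on colour W" "card W < k" "B \<subseteq> W"
  shows "\<exists>z \<in> layer k (Suc n). colour z \<notin> colour ` W \<and> parents z = W \<and> flipped_parents z = B"
proof -
  have fin: "finite W" "finite B" using assms finite_layer finite_subset by metis+
  have "card (colour ` W) < card {1..k}"
    using assms(3) card_image_le[OF fin(1), of colour] by simp
  then have "\<not> {1..k} \<subseteq> colour ` W"
    using fin(1) by (meson card_mono finite_imageI not_le)
  then obtain c where "c \<in> {1..k}" "c \<notin> colour ` W" by blast
  then show ?thesis
    using assms fin by (intro bexI[of _ "vertex c W B"]) (auto simp: vertex_simps)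
qed

definition layer_graph :: "nat \<Rightarrow> nat \<Rightarrow> nat pair_pre_digraph" where
  "layer_graph k n = \<lparr> pverts = layer k n,
     parcs = {(u, v). u \<in> layer k n \<and> v \<in> layer k n \<and> (u \<in> parents v \<or> v \<in> parents u)} \<rparr>"

lemma pair_graph_layer_graph: "pair_graph (layer_graph k n)"
proof -
  have "finite (parcs (layer_graph k n))"
    by (rule finite_subset[of _ "layer k n \<times> layer k n"]) (auto simp: layer_graph_def finite_layer)
  moreover have "symmetric (layer_graph k n)"
    unfolding symmetric_def sym_def by (auto simp: layer_graph_def)
  ultimately show ?thesis
    by unfold_locales (auto simp: layer_graph_def finite_layer dest: mem_parents_less)
qed

text \<open>
  Parents are smaller numbers, so the edges from \<open>v\<close> to its children do not count here.
\<close>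

lemma layer_graph_back_neighbours:
  assumes "v \<in> layer k n"
  shows "{u. (u, v) \<in> parcs (layer_graph k n) \<and> u < v} = parents v"
  using assms mem_parents_less layer_memD(2)[OF assms]
  by (auto simp: layer_graph_def dest: less_asym)

lemma colour_layer_graph_proper:
  assumes "(u, v) \<in> parcs (layer_graph k n)"
  shows "colour u \<noteq> colour v"
  using assms layer_memD(5)[of u k n] layer_memD(5)[of v k n]
  by (force simp: layer_graph_def image_iff)

lemma acyclic_coloring_layer_graph: "acyclic_coloring (layer_graph k n) k colour"
proof (rule acyclic_coloring_of_rainbow_back_neighbours[OF pair_graph_layer_graph])
  show "colour \<in> pverts (layer_graph k n) \<rightarrow> {1..k}"
    using layer_memD(1) by (auto simp: layer_graph_def)
  show "inj_on colour {u. (u, v) \<in> parcs (layer_graph k n) \<and> u < v}"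
    if "v \<in> pverts (layer_graph k n)" for v
    using that layer_graph_back_neighbours[of v k n] layer_memD(4)[of v k n]
    by (simp add: layer_graph_def)
qed (rule colour_layer_graph_proper)

text \<open>
  Adding vertices joined to everything chosen so far produces a clique of size \<open>k\<close>, which
  every proper colouring must give \<open>k\<close> colours.
\<close>

lemma acyclic_chromatic_number_layer_graph:
  assumes "k \<ge> 1" "k \<le> n"
  shows "acyclic_chromatic_number (layer_graph k n) = k"
proof -
  let ?E = "parcs (layer_graph k n)"
  have "\<exists>W \<subseteq> layer k m. card W = m \<and> inj_on colour W \<and> (\<forall>u \<in> W. \<forall>v \<in> W. u \<noteq> v \<longrightarrow> (u, v) \<in> ?E)"
    if "m \<le> k" for m
    using that
  proof (induction m)
    case (Suc m)
    then obtain W where W: "W \<subseteq> layer k m" "card W = m" "inj_on colour W"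
      "\<And>u v. u \<in> W \<Longrightarrow> v \<in> W \<Longrightarrow> u \<noteq> v \<Longrightarrow> (u, v) \<in> ?E" by auto
    obtain z where z: "z \<in> layer k (Suc m)" "colour z \<notin> colour ` W" "parents z = W"
      using layer_extension[OF W(1,3), of "{}"] W(2) Suc.prems by auto
    have "finite W" using W(1) finite_layer finite_subset by blast
    have "layer k m \<subseteq> layer k n" "layer k (Suc m) \<subseteq> layer k n"
      using Suc.prems assms(2) by (auto intro!: layer_mono simp del: layer.simps)
    then have "(z, w) \<in> ?E \<and> (w, z) \<in> ?E" if "w \<in> W" for w
      using z W(1) that by (auto simp: layer_graph_def simp del: layer.simps)
    then have clique: "\<forall>u \<in> insert z W. \<forall>v \<in> insert z W. u \<noteq> v \<longrightarrow> (u, v) \<in> ?E"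
      using W(4) by blast
    have "z \<notin> W" using z(2) by blast
    show ?case
    proof (intro exI[of _ "insert z W"] conjI clique)
      show "insert z W \<subseteq> layer k (Suc m)" using W(1) z(1) layer_mono_Suc by blast
      show "card (insert z W) = Suc m" using \<open>z \<notin> W\<close> \<open>finite W\<close> W(2) by simp
      show "inj_on colour (insert z W)" using W(3) z(2) \<open>z \<notin> W\<close> by simp
    qed
  qed (auto intro!: exI[of _ "{}"])
  then obtain W where W: "W \<subseteq> layer k k" "card W = k" "\<forall>u \<in> W. \<forall>v \<in> W. u \<noteq> v \<longrightarrow> (u, v) \<in> ?E"
    by blast
  have WV: "W \<subseteq> pverts (layer_graph k n)"
    using W(1) layer_mono[OF assms(2)] by (auto simp: layer_graph_def)
  have "k \<le> j" if "acyclic_coloring (layer_graph k n) j c" for j c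
  proof -
    have "c ` W \<subseteq> {1..j}" "\<And>u v. (u, v) \<in> ?E \<Longrightarrow> c u \<noteq> c v"
      using that WV by (auto simp: acyclic_coloring_def)
    then have "inj_on c W"
      using W(3) by (meson inj_onI)
    then have "card W \<le> card {1..j}"
      using \<open>c ` W \<subseteq> {1..j}\<close> by (intro card_inj_on_le) auto
    then show ?thesis using W(2) by simp
  qed
  then show ?thesis
    unfolding acyclic_chromatic_number_def
    using acyclic_coloring_layer_graph assms(1) by (intro Least_equality) blast+
qed

section \<open>Few inversions are not enough\<close>

text \<open>
  If no candidate orthogonal to the isotropic rainbow set \<open>S\<close> is isotropic, the vertices
  orthogonal to \<open>S\<close> have self-product 1. Build a set \<open>U\<close> of such vertices with all mutual
  products 1, up to \<open>card (S \<union> U) = k - 1\<close>, and a further vertex \<open>z\<close> orthogonal to \<open>S \<union> U\<close>.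
  For a fixed \<open>u \<in> U\<close> the vectors \<open>x\<^sub>v\<close> for \<open>v \<in> S\<close>, \<open>x\<^sub>v + x\<^sub>u\<close> for \<open>v \<in> U - {u}\<close>, and
  \<open>x\<^sub>z + x\<^sub>u\<close> are \<open>k - 1\<close> independent vectors that span a totally isotropic space, which
  dimension \<open>d\<close> cannot accommodate. The index \<open>n\<close> of a layer advances by one with each
  vertex added, hence by at most \<open>k\<close> in all.
\<close>

lemma isotropic_clique_extension:
  fixes L :: "nat \<Rightarrow> 'v set" and col :: "'v \<Rightarrow> nat" and x :: "'v \<Rightarrow> nat \<Rightarrow> bit"
  assumes mono: "\<And>n. L n \<subseteq> L (Suc n)"
    and ext: "\<And>n W B. n < N \<Longrightarrow> finite W \<Longrightarrow> W \<subseteq> L n \<Longrightarrow> inj_on col W \<Longrightarrow> card W < k \<Longrightarrow> B \<subseteq> W \<Longrightarrow>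
      \<exists>z \<in> L (Suc n). col z \<notin> col ` W \<and> (\<forall>w \<in> W. bit_dot d (x z) (x w) = of_bool (w \<in> B))"
    and d: "d < 2 * (k - 1)"
    and S: "finite S" "S \<subseteq> L n" "inj_on col S" "card S < k - 1"
    and orth: "\<And>a b. a \<in> S \<Longrightarrow> b \<in> S \<Longrightarrow> bit_dot d (x a) (x b) = 0"
    and N: "n + k \<le> N"
  shows "\<exists>z \<in> L (n + k). col z \<notin> col ` S \<and> (\<forall>w \<in> insert z S. bit_dot d (x z) (x w) = 0)"
proof (rule ccontr)
  assume none: "\<not> ?thesis"
  let ?D = "\<lambda>a b. bit_dot d (x a) (x b)"
  have comm: "?D a b = ?D b a" for a b by (rule bit_dot_commute)
  have le: "L i \<subseteq> L j" if "i \<le> j" for i j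
    using lift_Suc_mono_le[of L] mono that by blast
  have nonisotropic: "?D z z = 1"
    if "z \<in> L j" "j \<le> n + k" "col z \<notin> col ` S" "\<And>w. w \<in> S \<Longrightarrow> ?D z w = 0" for z j
  proof -
    have "z \<in> L (n + k)" using that(1,2) le by blast
    then have "?D z z \<noteq> 0" using none that(3,4) by blast
    then show ?thesis by simp
  qed
  have "\<exists>U \<subseteq> L (n + l). finite U \<and> card U = l \<and> S \<inter> U = {} \<and> inj_on col (S \<union> U) \<and>
      (\<forall>a \<in> S. \<forall>u \<in> U. ?D a u = 0) \<and> (\<forall>u \<in> U. \<forall>u' \<in> U. ?D u u' = 1)"
    if "l \<le> k - 1 - card S" for l
    using that
  proof (induction l)
    case 0
    show ?case using S by (intro exI[of _ "{}"]) auto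
  next
    case (Suc l)
    then obtain U where U: "U \<subseteq> L (n + l)" "finite U" "card U = l" "S \<inter> U = {}" "inj_on col (S \<union> U)"
      "\<And>a u. a \<in> S \<Longrightarrow> u \<in> U \<Longrightarrow> ?D a u = 0" "\<And>u u'. u \<in> U \<Longrightarrow> u' \<in> U \<Longrightarrow> ?D u u' = 1"
      by auto
    have SL: "S \<subseteq> L (n + l)" using S(2) le[of n "n + l"] by auto
    have "card (S \<union> U) < k"
      using Suc.prems S(1) U by (simp add: card_Un_disjoint)
    moreover have "n + l < N" using Suc.prems N by linarith
    ultimately obtain z where z: "z \<in> L (Suc (n + l))" "col z \<notin> col ` (S \<union> U)"
      "\<And>w. w \<in> S \<union> U \<Longrightarrow> ?D z w = of_bool (w \<in> U)"
      using ext[of "n + l" "S \<union> U" U] S(1) U SL by (meson Un_least Un_upper2 finite_UnI)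
    have zS: "?D z w = 0" if "w \<in> S" for w using z(3)[of w] that U(4) by auto
    have zU: "?D z w = 1" if "w \<in> U" for w using z(3)[of w] that by auto
    have "Suc (n + l) \<le> n + k" using Suc.prems by linarith
    then have zz: "?D z z = 1"
      using nonisotropic[OF z(1)] z(2) zS by auto
    have "z \<notin> S \<union> U" using z(2) by blast
    show ?case
    proof (intro exI[of _ "insert z U"] conjI ballI)
      show "insert z U \<subseteq> L (n + Suc l)" using z(1) U(1) mono by auto
      show "inj_on col (S \<union> insert z U)" using U(5) z(2) by auto
      show "card (insert z U) = Suc l" using U \<open>z \<notin> S \<union> U\<close> by simp
      show "S \<inter> insert z U = {}" using U(4) \<open>z \<notin> S \<union> U\<close> by blast
      show "?D a u = 0" if "a \<in> S" "u \<in> insert z U" for a u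
        using that U(6) zS comm by auto
      show "?D u u' = 1" if "u \<in> insert z U" "u' \<in> insert z U" for u u'
        using that U(7) zU zz comm by auto
    qed (use U in simp)
  qed
  from this[OF order_refl] obtain U where
    U: "U \<subseteq> L (n + (k - 1 - card S))" "finite U" "card U = k - 1 - card S" "S \<inter> U = {}"
      "inj_on col (S \<union> U)"
      "\<And>a u. a \<in> S \<Longrightarrow> u \<in> U \<Longrightarrow> ?D a u = 0" "\<And>u u'. u \<in> U \<Longrightarrow> u' \<in> U \<Longrightarrow> ?D u u' = 1"
    by auto
  define l where "l = n + (k - 1 - card S)"
  have l: "l < N" "Suc l \<le> n + k" using N S(4) by (auto simp: l_def)
  have W: "S \<union> U \<subseteq> L l" "card (S \<union> U) = k - 1"
    using U(1) S(2) le[OF le_add1, of n "k - 1 - card S"] U(2-4) S(1,4)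
    by (auto simp only: l_def card_Un_disjoint)
  have pattern: "\<exists>z \<in> L (Suc l). col z \<notin> col ` (S \<union> U) \<and> (\<forall>w \<in> S \<union> U. ?D z w = of_bool (w \<in> B))"
    if "B \<subseteq> S \<union> U" for B
    using ext[OF l(1) _ W(1) U(5) _ that] W(2) S U(2) by auto
  obtain z where z: "z \<in> L (Suc l)" "col z \<notin> col ` (S \<union> U)" "\<And>w. w \<in> S \<union> U \<Longrightarrow> ?D z w = 0"
    using pattern[of "{}"] by auto
  have zz: "?D z z = 1"
    using nonisotropic[OF z(1) l(2)] z by auto
  obtain u where u: "u \<in> U" using U(3) S(4) by fastforce
  \<comment> \<open>The index \<open>u\<close>, whose own sum \<open>x u + x u\<close> would vanish, carries the vector built from \<open>z\<close>.\<close>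
  define t where "t v = (if v \<in> S then x v else if v = u then (\<lambda>i. x z i + x u i) else (\<lambda>i. x v i + x u i))" for v
  have uS: "u \<notin> S" using u U(4) by blast
  have "2 * card (S \<union> U) \<le> d"
  proof (rule two_card_isotropic_le[where t = t])
    show "finite (S \<union> U)" using S(1) U(2) by simp
    have sum2: "bit_dot d (\<lambda>i. x a i + x u i) (\<lambda>i. x b i + x u i) = 0"
      if "?D a b = ?D a u + (?D u b + 1)" for a b
      unfolding bit_dot_add_left bit_dot_add_right that U(7)[OF u u]
      by (cases "?D a u"; cases "?D u b") simp_all
    have uz: "?D u z = 0" using z(3)[of u] u comm by auto
    show "bit_dot d (t a) (t b) = 0" if ab: "a \<in> S \<union> U" "b \<in> S \<union> U" for a b
    proof -
      have S_add: "bit_dot d (x a) (\<lambda>i. x b i + x u i) = 0" if "a \<in> S" "?D a b = 0" for a b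
        unfolding bit_dot_add_right using that U(6)[OF that(1) u] by simp
      have add_S: "bit_dot d (\<lambda>i. x b i + x u i) (x a) = 0" if "a \<in> S" "?D a b = 0" for a b
        using S_add[OF that] bit_dot_commute by metis
      have Sz: "?D a z = 0" if "a \<in> S" for a using z(3)[of a] that comm by auto
      consider "a \<in> S" "b \<in> S" | "a \<in> S" "b \<in> U" | "a \<in> U" "b \<in> S" | "a \<in> U" "b \<in> U"
        using ab by blast
      then show ?thesis
      proof cases
        case 1
        then show ?thesis using orth by (simp add: t_def)
      next
        case 2
        then have "b \<notin> S" using U(4) by blast
        then show ?thesis using 2 U(6) Sz S_add by (simp add: t_def)
      next
        case 3
        then have "a \<notin> S" using U(4) by blast
        then show ?thesis using 3 U(6) Sz add_S by (simp add: t_def)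
      next
        case 4
        then have "a \<notin> S" "b \<notin> S" using U(4) by blast+
        moreover have "?D z z = ?D z u + (?D u z + 1)" "?D z b = ?D z u + (?D u b + 1)"
          "?D a z = ?D a u + (?D u z + 1)" "?D a b = ?D a u + (?D u b + 1)"
          using zz uz comm[of z u] comm[of a z] z(3)[of a] z(3)[of b] 4 U(7) u by simp_all
        ultimately show ?thesis using sum2 by (simp add: t_def del: add_bit_eq_xor)
      qed
    qed
    show "\<exists>y. \<forall>a \<in> S \<union> U. bit_dot d y (t a) = of_bool (a \<in> J)" if "J \<subseteq> S \<union> U" for J
    proof -
      have "J - {u} \<subseteq> S \<union> U" using that by blast
      from pattern[OF this] obtain y where y: "\<And>w. w \<in> S \<union> U \<Longrightarrow> ?D y w = of_bool (w \<in> J - {u})"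
        by blast
      have yu: "?D y u = 0" using y[of u] u by simp
      have yt: "bit_dot d (x y) (t a) = of_bool (a \<in> J)" if "a \<in> S \<union> U" "a \<noteq> u" for a
        using that y[of a] yu by (auto simp: t_def bit_dot_add_right simp del: add_bit_eq_xor)
      have ut: "bit_dot d (x u) (t a) = 0" if "a \<in> S \<union> U" "a \<noteq> u" for a
        using that U(6,7) u comm[of u a] by (auto simp: t_def bit_dot_add_right simp del: add_bit_eq_xor)
      have utu: "bit_dot d (x u) (t u) = 1"
        using uS uz U(7)[OF u u] by (simp add: t_def bit_dot_add_right del: add_bit_eq_xor)
      \<comment> \<open>Adding \<open>x u\<close> changes the product with \<open>t u\<close> only, so it corrects that entry of the pattern.\<close>
      show ?thesis
      proof (cases "bit_dot d (x y) (t u) = of_bool (u \<in> J)")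
        case True
        then have "\<forall>a \<in> S \<union> U. bit_dot d (x y) (t a) = of_bool (a \<in> J)"
          using yt by metis
        then show ?thesis by blast
      next
        case False
        have "bit_dot d (\<lambda>i. x y i + x u i) (t a) = of_bool (a \<in> J)" if "a \<in> S \<union> U" for a
        proof (cases "a = u")
          case True
          then show ?thesis
            using False utu by (cases "bit_dot d (x y) (t u)") (auto simp: bit_dot_add_left simp del: add_bit_eq_xor)
        next
          case False
          then show ?thesis using yt ut that by (simp add: bit_dot_add_left del: add_bit_eq_xor)
        qed
        then show ?thesis by blast
      qed
    qed
  qed
  then show False using d W(2) by simp
qed

text \<open>
  Starting from the empty set, \<open>k - 1\<close> extensions, each of which uses at most \<open>k\<close> layers, and one
  more layer for the patterns stay within \<open>k * k\<close> layers. The vertices used depend on the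
  vectors \<open>x\<close>, but the number of layers does not, so one finite graph defeats all choices of \<open>x\<close>.
\<close>

lemma dimension_ge_of_rainbow_extensions:
  fixes L :: "nat \<Rightarrow> 'v set" and col :: "'v \<Rightarrow> nat" and x :: "'v \<Rightarrow> nat \<Rightarrow> bit"
  assumes mono: "\<And>n. L n \<subseteq> L (Suc n)"
    and ext: "\<And>n W B. n < k * k \<Longrightarrow> finite W \<Longrightarrow> W \<subseteq> L n \<Longrightarrow> inj_on col W \<Longrightarrow> card W < k \<Longrightarrow> B \<subseteq> W \<Longrightarrow>
      \<exists>z \<in> L (Suc n). col z \<notin> col ` W \<and> (\<forall>w \<in> W. bit_dot d (x z) (x w) = of_bool (w \<in> B))"
    and "k \<ge> 1"
  shows "2 * (k - 1) \<le> d"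
proof (rule ccontr)
  assume "\<not> ?thesis"
  then have d: "d < 2 * (k - 1)" by simp
  have "\<exists>S \<subseteq> L (m * k). finite S \<and> card S = m \<and> inj_on col S \<and>
      (\<forall>a \<in> S. \<forall>b \<in> S. bit_dot d (x a) (x b) = 0)" if "m \<le> k - 1" for m
    using that
  proof (induction m)
    case 0
    then show ?case by (intro exI[of _ "{}"]) auto
  next
    case (Suc m)
    then obtain S where S: "S \<subseteq> L (m * k)" "finite S" "card S = m" "inj_on col S"
      "\<And>a b. a \<in> S \<Longrightarrow> b \<in> S \<Longrightarrow> bit_dot d (x a) (x b) = 0" by auto
    have "Suc m * k \<le> k * k" using Suc.prems by (intro mult_le_mono1) simp
    then have N: "m * k + k \<le> k * k" by simp
    have "card S < k - 1" using S(3) Suc.prems by simp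
    from isotropic_clique_extension[OF mono ext d S(2,1,4) this S(5) N]
    obtain z where z: "z \<in> L (m * k + k)" "col z \<notin> col ` S"
      "\<And>w. w \<in> insert z S \<Longrightarrow> bit_dot d (x z) (x w) = 0" by blast
    have "L (m * k) \<subseteq> L (m * k + k)"
      using lift_Suc_mono_le[of L] mono by (metis le_add1)
    moreover have "z \<notin> S" using z(2) by blast
    moreover have "bit_dot d (x a) (x b) = 0" if "a \<in> insert z S" "b \<in> insert z S" for a b
      using that S(5) z(3) bit_dot_commute by (metis insertE)
    ultimately show ?case
      using S(1-4) z(1,2)
      by (intro exI[of _ "insert z S"] conjI ballI) (simp_all add: add.commute subset_trans)
  qed
  from this[OF order_refl] obtain S where S: "S \<subseteq> L ((k - 1) * k)" "finite S" "card S = k - 1" "inj_on col S"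
    "\<And>a b. a \<in> S \<Longrightarrow> b \<in> S \<Longrightarrow> bit_dot d (x a) (x b) = 0" by blast
  have "(k - 1) * k < k * k" "card S < k" using assms(3) S(3) by simp_all
  have "2 * card S \<le> d"
  proof (rule two_card_isotropic_le[where t = x, OF S(2)])
    fix J assume "J \<subseteq> S"
    then show "\<exists>y. \<forall>a \<in> S. bit_dot d y (x a) = of_bool (a \<in> J)"
      using ext[OF \<open>(k - 1) * k < k * k\<close> S(2,1,4) \<open>card S < k\<close>] by blast
  qed (rule S(5))
  then show False using d S(3) by simp
qed

section \<open>The inversion diameter\<close>

lemma layer_graph_inversions_upper:
  assumes D: "D \<in> orientations (layer_graph k n)" and D': "D' \<in> orientations (layer_graph k n)"
  shows "\<exists>Xs. (\<forall>X \<in> set Xs. X \<subseteq> pverts (layer_graph k n)) \<and> length Xs = 2 * (k - 1) \<and>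
    D' = fold invert Xs D"
proof -
  let ?G = "layer_graph k n"
  define \<pi> :: "nat \<Rightarrow> nat \<Rightarrow> bit" where "\<pi> u v = of_bool ((u, v) \<in> D \<longleftrightarrow> (u, v) \<notin> D')" for u v
  have \<pi>_sym: "\<pi> u v = \<pi> v u" if "(u, v) \<in> parcs ?G" for u v
    using that D D' by (auto simp: \<pi>_def orientations_def)
  have "\<exists>x. \<forall>v \<in> layer k n. \<forall>u \<in> parents v. bit_dot (2 * (k - 1)) (x u) (x v) = \<pi> u v"
    using layer_memD mem_parents_less
    by (intro exists_vectors_of_rainbow_back_neighbours[where c = colour] finite_layer) blast+
  then obtain x where x: "bit_dot (2 * (k - 1)) (x u) (x v) = \<pi> u v"
    if "v \<in> layer k n" "u \<in> parents v" for u v by blast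
  have x_arc: "bit_dot (2 * (k - 1)) (x u) (x v) = \<pi> u v" if "(u, v) \<in> parcs ?G" for u v
    using that x[of v u] x[of u v] \<pi>_sym[OF that] bit_dot_commute[of _ "x u" "x v"]
    by (auto simp: layer_graph_def)
  define Xs where "Xs = map (\<lambda>i. {v \<in> layer k n. x v i = 1}) [0..<2 * (k - 1)]"
  have len: "length Xs = 2 * (k - 1)" by (simp add: Xs_def)
  have vec: "membership_vector Xs v i = x v i" if "v \<in> layer k n" "i < 2 * (k - 1)" for v i
    using that by (cases "x v i") (simp_all add: membership_vector_def Xs_def)
  have dot: "bit_dot (length Xs) (membership_vector Xs u) (membership_vector Xs v) = \<pi> u v"
    if "(u, v) \<in> parcs ?G" for u v
  proof -
    have "u \<in> layer k n" "v \<in> layer k n" using that by (auto simp: layer_graph_def)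
    then have "bit_dot (length Xs) (membership_vector Xs u) (membership_vector Xs v) =
        bit_dot (2 * (k - 1)) (x u) (x v)"
      unfolding bit_dot_def len using vec by (intro sum.cong) auto
    then show ?thesis using x_arc[OF that] by simp
  qed
  then have "fold invert Xs D = D'"
    unfolding fold_invert_eq_iff[OF pair_graph_layer_graph D D'] \<pi>_def by blast
  then show ?thesis
    using len by (intro exI[of _ Xs]) (auto simp: Xs_def layer_graph_def)
qed

definition increasing_orientation :: "nat \<Rightarrow> nat \<Rightarrow> nat rel" where
  "increasing_orientation k n = {(u, v) \<in> parcs (layer_graph k n). u < v}"

text \<open>
  The orientation that differs from the increasing one exactly on the edges with label 1.
\<close>

definition flipped_orientation :: "nat \<Rightarrow> nat \<Rightarrow> nat rel" where
  "flipped_orientation k n = {(u, v) \<in> parcs (layer_graph k n).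
     u < v \<longleftrightarrow> \<not> (u \<in> flipped_parents v \<or> v \<in> flipped_parents u)}"

lemma orientations_layer_graph:
  "increasing_orientation k n \<in> orientations (layer_graph k n)"
  "flipped_orientation k n \<in> orientations (layer_graph k n)"
proof -
  have "u < v \<longleftrightarrow> \<not> v < u" "(v, u) \<in> parcs (layer_graph k n)" if "(u, v) \<in> parcs (layer_graph k n)" for u v
    using that by (auto simp: layer_graph_def dest: mem_parents_less)
  then show "increasing_orientation k n \<in> orientations (layer_graph k n)"
    "flipped_orientation k n \<in> orientations (layer_graph k n)"
    unfolding increasing_orientation_def flipped_orientation_def orientations_def by blast+
qed

lemma layer_graph_inversions_lower:
  assumes "k \<ge> 1"
    and Xs: "flipped_orientation k (k * k) = fold invert Xs (increasing_orientation k (k * k))"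
  shows "2 * (k - 1) \<le> length Xs"
proof (rule dimension_ge_of_rainbow_extensions[where L = "layer k" and col = colour and x = "membership_vector Xs"])
  let ?n = "k * k"
  fix n W B
  assume n: "n < ?n" and W: "W \<subseteq> layer k n" "inj_on colour W" "card W < k" "B \<subseteq> W"
  then obtain z where z: "z \<in> layer k (Suc n)" "colour z \<notin> colour ` W" "parents z = W" "flipped_parents z = B"
    using layer_extension by blast
  have "bit_dot (length Xs) (membership_vector Xs z) (membership_vector Xs w) = of_bool (w \<in> B)"
    if w: "w \<in> W" for w
  proof -
    have "w \<in> layer k ?n" "z \<in> layer k ?n"
      using w W(1) z(1) n layer_mono[of n ?n k] layer_mono[of "Suc n" ?n k] by (auto simp del: layer.simps)
    then have arc: "(w, z) \<in> parcs (layer_graph k ?n)"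
      using w z(3) by (auto simp: layer_graph_def)
    have "w < z" using w z(3) mem_parents_less by blast
    moreover have "z \<notin> flipped_parents w"
      using layer_memD(3)[OF \<open>w \<in> layer k ?n\<close>] mem_parents_less \<open>w < z\<close> by (meson less_asym subsetD)
    ultimately have "((w, z) \<in> increasing_orientation k ?n \<longleftrightarrow> (w, z) \<notin> flipped_orientation k ?n) \<longleftrightarrow> w \<in> B"
      using arc z(4) by (simp add: increasing_orientation_def flipped_orientation_def)
    moreover have "\<forall>(u, v) \<in> parcs (layer_graph k ?n).
        bit_dot (length Xs) (membership_vector Xs u) (membership_vector Xs v) =
          of_bool ((u, v) \<in> increasing_orientation k ?n \<longleftrightarrow> (u, v) \<notin> flipped_orientation k ?n)"
      using fold_invert_eq_iff[OF pair_graph_layer_graph orientations_layer_graph, of Xs] Xs[symmetric]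
      by (rule iffD1)
    ultimately have "bit_dot (length Xs) (membership_vector Xs w) (membership_vector Xs z) = of_bool (w \<in> B)"
      using arc by auto
    then show ?thesis
      by (simp only: bit_dot_commute[of _ "membership_vector Xs z"])
  qed
  then show "\<exists>z \<in> layer k (Suc n). colour z \<notin> colour ` W \<and>
      (\<forall>w \<in> W. bit_dot (length Xs) (membership_vector Xs z) (membership_vector Xs w) = of_bool (w \<in> B))"
    using z(1,2) by blast
qed (rule layer_mono_Suc, rule assms(1))

theorem theorem3p1:
  fixes k :: nat
  assumes "k \<ge> 2"
  shows "\<exists>G :: nat pair_pre_digraph. pair_graph G \<and>
           acyclic_chromatic_number G = k \<and>
           graph_diameter (inversion_graph G) = ereal (2 * real k - 2)"
proof (intro exI conjI)
  let ?G = "layer_graph k (k * k)"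
  show "pair_graph ?G" by (rule pair_graph_layer_graph)
  show "acyclic_chromatic_number ?G = k"
    using assms by (intro acyclic_chromatic_number_layer_graph) auto
  have "graph_diameter (inversion_graph ?G) = ereal (real (2 * (k - 1)))"
  proof (rule graph_diameter_inversion_graph_eqI[OF pair_graph_layer_graph _ orientations_layer_graph])
    show "2 * (k - 1) \<le> length Xs"
      if "flipped_orientation k (k * k) = fold invert Xs (increasing_orientation k (k * k))" for Xs
      using layer_graph_inversions_lower[OF _ that] assms by linarith
  qed (rule layer_graph_inversions_upper)
  then show "graph_diameter (inversion_graph ?G) = ereal (2 * real k - 2)"
    using assms by (simp add: of_nat_diff)
qed

end
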